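(* Let $n,k,t$ be positive integers with $k\geq 2$ and $t\geq 2$. Any $(1,t)$-union intersecting family $\mathcal{A}\subseteq {[n]\choose k}$ of size at least $${n-1\choose k-1}-{n-k-1\choose k-1}+(t-1){2k-1\choose k-1}+t$$ is contained in some star $\mathcal{S}_i$. In particular, if $n\geq \frac{3k}{2}\left(1+\left(t-1+\frac{t}{{2k-1\choose k-1}}\right)^{\frac{1}{k-1}}\right)$ and $\mathcal{A}\subseteq{[n]\choose k}$ is $(1,t)$-union intersecting, then $|\mathcal{A}|\leq{n-1\choose k-1}$, and equality holds if and only if $\mathcal{A}=\mathcal{S}_i$ for some $i\in [n]$.
   Context: ${[n]\choose k}$ denotes the family of all $k$-subsets of $[n]=\{1,\ldots,n\}$. For $i\in[n]$, the star is $\mathcal{S}_i=\{A\in{[n]\choose k}: i\in A\}$. A family $\mathcal{A}\subseteq{[n]\choose k}$ is $(1,t)$-union intersecting if for every $A\in\mathcal{A}$ and every $t$-element subfamily $\{B_1,\ldots,B_t\}\subseteq\mathcal{A}$ we have $A\cap\left(\bigcup_{i=1}^t B_i\right)\neq\varnothing$. *)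

theory Defs
  imports Complex_Main "HOL-Library.Ramsey"
begin

definition star :: "nat \<Rightarrow> nat \<Rightarrow> nat \<Rightarrow> nat set set" where
  "star n k i = {A \<in> nsets {1..n} k. i \<in> A}"

text \<open>The members of \<open>\<B>\<close> are pairwise distinct, but \<open>A\<close> itself may belong to \<open>\<B>\<close>.\<close>

definition one_union_intersecting :: "nat \<Rightarrow> 'a set set \<Rightarrow> bool" where
  "one_union_intersecting t \<A> \<longleftrightarrow>
     (\<forall>A\<in>\<A>. \<forall>\<B>\<in>nsets \<A> t. A \<inter> \<Union>\<B> \<noteq> {})"

end

theory Submission
  imports Defs "HOL-Computational_Algebra.Polynomial" "HOL-Library.FuncSet"
begin

text \<open>
  Every member of a \<open>(1,t)\<close>-union intersecting family \<open>F\<close> is disjoint from at most \<open>t - 1\<close> others.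
  Repeatedly pick a disjoint pair \<open>(A, B)\<close> and delete all members disjoint from \<open>A\<close>. The pairs picked
  form, together with their mirror images, a skew cross-intersecting system, so by the skew
  Bollobas theorem there are at most \<open>(2k-1 choose k-1)\<close> of them. Hence deleting at most
  \<open>(t-1)(2k-1 choose k-1)\<close> members leaves an intersecting family \<open>F'\<close>. If \<open>F'\<close> is not contained in a
  star, the Hilton--Milner theorem bounds it. If it is contained in the star of \<open>x\<close> but \<open>F\<close> has a
  member \<open>B\<close> avoiding \<open>x\<close>, then all but \<open>t - 1\<close> members of \<open>F'\<close> meet \<open>B\<close>.

  The skew Bollobas bound is a rank bound for the matrix of resultants
  \<open>\<Prod>a\<in>A. \<Prod>b\<in>B. b - a\<close>, whose entries vanish exactly when \<open>A\<close> and \<open>B\<close> meet. Hilton--Milner follows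
  the shifting argument of Frankl and Fueredi, with all shifts going into one fixed \<open>2k\<close>-set.
\<close>

subsection \<open>The skew Bollobas theorem\<close>

text \<open>Gaussian elimination, one equation \<open>x\<close> at a time: an unknown
  \<open>p\<close> with nonzero coefficient in \<open>x\<close> is solved for and substituted into
  the remaining equations. Here \<open>g j x\<close> is the coefficient of the unknown
  \<open>j\<close> in equation \<open>x\<close>.\<close>

lemma homogeneous_system_nontrivial_solution:
  fixes g :: "'j \<Rightarrow> 'x \<Rightarrow> 'a::field"
  assumes "finite X" "finite J" "card X < card J"
  shows "\<exists>c. (\<exists>j\<in>J. c j \<noteq> 0) \<and> (\<forall>x\<in>X. (\<Sum>j\<in>J. c j * g j x) = 0)"
  using assms
proof (induction X arbitrary: J g rule: finite_induct)
  case empty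
  then have "J \<noteq> {}" by auto
  then show ?case by (intro exI[of _ "\<lambda>_. 1"]) auto
next
  case (insert x X)
  show ?case
  proof (cases "\<forall>j\<in>J. g j x = 0")
    case True
    have "card X < card J" using insert by simp
    from insert.IH[OF insert.prems(1) this, of g] obtain c where
      "\<exists>j\<in>J. c j \<noteq> 0" "\<forall>y\<in>X. (\<Sum>j\<in>J. c j * g j y) = 0" by blast
    with True show ?thesis by (intro exI[of _ c]) auto
  next
    case False
    then obtain p where p: "p \<in> J" "g p x \<noteq> 0" by blast
    define J' where "J' = J - {p}"
    define g' where "g' = (\<lambda>j y. g j y - g j x / g p x * g p y)"
    have fin: "finite J'" and J: "J = insert p J'" "p \<notin> J'"
      using p insert.prems by (auto simp: J'_def)
    have "card X < card J'" using insert J fin by simp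
    from insert.IH[OF fin this, of g'] obtain c where
      c: "\<exists>j\<in>J'. c j \<noteq> 0" "\<forall>y\<in>X. (\<Sum>j\<in>J'. c j * g' j y) = 0" by blast
    define d where "d = c(p := - (\<Sum>j\<in>J'. c j * g j x / g p x))"
    have d: "(\<Sum>j\<in>J. d j * g j y) = (\<Sum>j\<in>J'. c j * g' j y)" for y
    proof -
      have "(\<Sum>j\<in>J. d j * g j y) = d p * g p y + (\<Sum>j\<in>J'. d j * g j y)"
        using J fin by simp
      also have "(\<Sum>j\<in>J'. d j * g j y) = (\<Sum>j\<in>J'. c j * g j y)"
        using J by (intro sum.cong) (auto simp: d_def)
      also have "d p * g p y = - (\<Sum>j\<in>J'. c j * (g j x / g p x * g p y))"
        by (simp add: d_def sum_distrib_right mult.assoc)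
      finally show ?thesis
        by (simp add: g'_def right_diff_distrib sum_subtractf)
    qed
    have "g' j x = 0" for j using p by (simp add: g'_def)
    then have "\<forall>y\<in>insert x X. (\<Sum>j\<in>J. d j * g j y) = 0"
      using c(2) by (simp add: d)
    moreover have "\<exists>j\<in>J. d j \<noteq> 0"
      using c(1) J by (auto simp: d_def)
    ultimately show ?thesis by blast
  qed
qed

text \<open>The sums are the entries of an \<open>m\<close> by \<open>m\<close> matrix that factors
  through \<open>X\<close>, so its rank is at most \<open>card X\<close>; being triangular with
  nonzero diagonal, it has rank \<open>m\<close>. Concretely, if \<open>m\<close> were larger, a
  nontrivial combination of the \<open>g j\<close> would vanish on \<open>X\<close>, and pairing it
  with \<open>f i\<close>, for \<open>i\<close> the least index in its support, isolates a diagonal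
  entry.\<close>

lemma triangular_factorization_bound:
  fixes f g :: "nat \<Rightarrow> 'x \<Rightarrow> 'a::field"
  assumes "finite X"
    and diag: "\<And>i. i < m \<Longrightarrow> (\<Sum>x\<in>X. f i x * g i x) \<noteq> 0"
    and upper: "\<And>i j. i < j \<Longrightarrow> j < m \<Longrightarrow> (\<Sum>x\<in>X. f i x * g j x) = 0"
  shows "m \<le> card X"
proof (rule ccontr)
  assume "\<not> m \<le> card X"
  then have "card X < card {..<m}" by simp
  from homogeneous_system_nontrivial_solution[OF assms(1) _ this, of g]
  obtain c where c: "\<exists>j<m. c j \<noteq> 0" "\<And>x. x \<in> X \<Longrightarrow> (\<Sum>j<m. c j * g j x) = 0" by auto
  define i where "i = (LEAST j. c j \<noteq> 0)"
  have ci: "c i \<noteq> 0" and i: "i < m" and less: "\<And>j. j < i \<Longrightarrow> c j = 0"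
  proof -
    obtain j where j: "j < m" "c j \<noteq> 0" using c(1) by blast
    show "c i \<noteq> 0" unfolding i_def using j(2) by (rule LeastI)
    show "i < m" unfolding i_def using Least_le[of "\<lambda>j. c j \<noteq> 0", OF j(2)] j(1) by simp
    show "c j = 0" if "j < i" for j using not_less_Least[OF that[unfolded i_def]] by simp
  qed
  have "0 = (\<Sum>x\<in>X. f i x * (\<Sum>j<m. c j * g j x))" using c(2) by simp
  also have "\<dots> = (\<Sum>j<m. c j * (\<Sum>x\<in>X. f i x * g j x))"
    unfolding sum_distrib_left by (subst sum.swap) (simp add: mult_ac)
  also have "\<dots> = (\<Sum>j<m. if j = i then c i * (\<Sum>x\<in>X. f i x * g i x) else 0)"
    using less upper by (intro sum.cong) (auto simp: neq_iff)
  also have "\<dots> = c i * (\<Sum>x\<in>X. f i x * g i x)" using i by simp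
  finally show False using ci diag[OF i] by simp
qed

lemma prod_linear_factors_expansion:
  fixes f :: "'b \<Rightarrow> 'a::idom"
  assumes "finite A"
  obtains c where "\<And>x. (\<Prod>a\<in>A. x - f a) = (\<Sum>s\<le>card A. c s * x ^ s)"
proof -
  define p where "p = (\<Prod>a\<in>A. [:- f a, 1:])"
  have "degree p \<le> (\<Sum>a\<in>A. degree [:- f a, 1:])"
    unfolding p_def using degree_prod_sum_le[OF assms, of "\<lambda>a. [:- f a, 1:]"] by (simp add: o_def)
  then have deg: "degree p \<le> card A" by simp
  have "(\<Prod>a\<in>A. x - f a) = (\<Sum>s\<le>card A. coeff p s * x ^ s)" for x
  proof -
    have "(\<Prod>a\<in>A. x - f a) = poly p x" by (simp add: p_def poly_prod)
    also have "\<dots> = poly (\<Sum>s\<le>card A. monom (coeff p s) s) x"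
      by (simp add: poly_as_sum_of_monoms'[OF deg])
    finally show ?thesis by (simp add: poly_sum poly_monom)
  qed
  then show ?thesis by (rule that)
qed

text \<open>A symmetric expansion: selecting the exponent \<open>g b\<close> in the factor belonging to \<open>b\<close>, the
  coefficient product depends only on how often each exponent is selected.\<close>

lemma prod_polynomial_values_expansion:
  fixes f :: "'b \<Rightarrow> 'a::comm_ring_1"
  assumes "finite B"
  obtains Q where "\<And>c. (\<Prod>b\<in>B. \<Sum>s\<le>r. c s * f b ^ s) =
     (\<Sum>l\<in>{l. length l = Suc r \<and> sum_list l = card B}. (\<Prod>s\<le>r. c s ^ (l ! s)) * Q l)"
proof -
  let ?L = "{l. length l = Suc r \<and> sum_list l = card B}"
  let ?G = "PiE B (\<lambda>_. {..r})"
  define prof where "prof = (\<lambda>g. map (\<lambda>s. card {b \<in> B. g b = s}) [0..<Suc r])"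
  have finL: "finite ?L"
  proof (rule finite_subset)
    show "?L \<subseteq> {l. set l \<subseteq> {..card B} \<and> length l = Suc r}"
      using member_le_sum_list by fastforce
    show "finite {l. set l \<subseteq> {..card B} \<and> length l = Suc r}"
      by (rule finite_lists_length_eq) simp
  qed
  have finG: "finite ?G" using assms by (intro finite_PiE) auto
  have prof: "prof ` ?G \<subseteq> ?L"
  proof safe
    fix g assume g: "g \<in> ?G"
    show "length (prof g) = Suc r" by (simp add: prof_def)
    have "sum_list (prof g) = (\<Sum>s\<le>r. card {b \<in> B. g b = s})"
      by (simp add: prof_def sum_list_sum_nth atLeast0LessThan lessThan_Suc_atMost del: upt_Suc)
    also have "\<dots> = (\<Sum>s\<le>r. \<Sum>b\<in>{b \<in> B. g b = s}. 1)" by simp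
    also have "\<dots> = (\<Sum>b\<in>B. 1)"
      using assms g by (intro sum.group) auto
    finally show "sum_list (prof g) = card B" by simp
  qed
  \<comment> \<open>\<open>Q l\<close> collects all selections with exponent profile
    \<open>l\<close> and does not mention \<open>c\<close>; this separates the two factors of the
    expansion.\<close>
  define Q where "Q = (\<lambda>l. \<Sum>g\<in>{g \<in> ?G. prof g = l}. \<Prod>b\<in>B. f b ^ g b)"
  have "(\<Prod>b\<in>B. \<Sum>s\<le>r. c s * f b ^ s) = (\<Sum>l\<in>?L. (\<Prod>s\<le>r. c s ^ (l ! s)) * Q l)" for c
  proof -
    have coeff: "(\<Prod>b\<in>B. c (g b)) = (\<Prod>s\<le>r. c s ^ (prof g ! s))" if g: "g \<in> ?G" for g
    proof -
      have "(\<Prod>b\<in>B. c (g b)) = (\<Prod>s\<le>r. \<Prod>b\<in>{b \<in> B. g b = s}. c (g b))"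
        using assms g by (intro prod.group[symmetric]) auto
      also have "\<dots> = (\<Prod>s\<le>r. c s ^ (prof g ! s))"
        by (intro prod.cong) (auto simp: prof_def less_Suc_eq_le simp del: upt_Suc)
      finally show ?thesis .
    qed
    have "(\<Prod>b\<in>B. \<Sum>s\<le>r. c s * f b ^ s) = (\<Sum>g\<in>?G. \<Prod>b\<in>B. c (g b) * f b ^ g b)"
      using assms by (subst prod_sum_PiE) auto
    also have "\<dots> = (\<Sum>g\<in>?G. (\<Prod>s\<le>r. c s ^ (prof g ! s)) * (\<Prod>b\<in>B. f b ^ g b))"
      by (intro sum.cong) (auto simp: prod.distrib coeff)
    also have "\<dots> = (\<Sum>l\<in>?L. \<Sum>g\<in>{g \<in> ?G. prof g = l}.
        (\<Prod>s\<le>r. c s ^ (prof g ! s)) * (\<Prod>b\<in>B. f b ^ g b))"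
      by (rule sum.group[OF finG finL prof, symmetric])
    also have "\<dots> = (\<Sum>l\<in>?L. (\<Prod>s\<le>r. c s ^ (l ! s)) * Q l)"
      by (intro sum.cong) (auto simp: Q_def sum_distrib_left)
    finally show ?thesis .
  qed
  then show ?thesis by (rule that)
qed

text \<open>The resultant of \<open>A\<close> and \<open>B\<close> is homogeneous of degree
  \<open>b\<close> in the \<open>a + 1\<close> coefficients of the polynomial with root set
  \<open>A\<close>. Its monomials are indexed by \<open>?L\<close>, so the matrix of resultants
  factors through a set of size \<open>(a + b) choose a\<close>.\<close>

theorem skew_bollobas:
  fixes ps :: "('a set \<times> 'a set) list"
  assumes skew: "sorted_wrt (\<lambda>p q. fst p \<inter> snd q \<noteq> {}) ps"
    and ps: "\<And>A B. (A, B) \<in> set ps \<Longrightarrow>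
      finite A \<and> finite B \<and> card A = a \<and> card B = b \<and> A \<inter> B = {}"
  shows "length ps \<le> (a + b) choose a"
proof -
  define U where "U = (\<Union>(A, B)\<in>set ps. A \<union> B)"
  have "finite U" using ps by (auto simp: U_def)
  then obtain h :: "'a \<Rightarrow> nat" where h: "inj_on h U"
    using finite_imp_inj_to_nat_seg by metis
  \<comment> \<open>The elements become distinct rationals, so a factor \<open>f x - f y\<close>
    vanishes only for \<open>x = y\<close>.\<close>
  define f where "f x = (of_nat (h x) :: rat)" for x
  have f: "f x = f y \<longleftrightarrow> x = y" if "x \<in> U" "y \<in> U" for x y
    using h that by (auto simp: f_def inj_on_def)
  let ?A = "\<lambda>i. fst (ps ! i)" and ?B = "\<lambda>i. snd (ps ! i)"
  let ?L = "{l. length l = Suc a \<and> sum_list l = b}"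
  have AB: "finite (?A i)" "finite (?B i)" "card (?A i) = a" "card (?B i) = b"
    "?A i \<inter> ?B i = {}" "?A i \<subseteq> U" "?B i \<subseteq> U" if "i < length ps" for i
  proof -
    have *: "(?A i, ?B i) \<in> set ps" using that by simp
    show "finite (?A i)" "finite (?B i)" "card (?A i) = a" "card (?B i) = b" "?A i \<inter> ?B i = {}"
      using ps[OF *] by simp_all
    show "?A i \<subseteq> U" "?B i \<subseteq> U" using UN_upper[OF *, of "\<lambda>(A, B). A \<union> B"] by (auto simp: U_def)
  qed
  have "\<exists>c. \<forall>x. (\<Prod>y\<in>?A i. x - f y) = (\<Sum>s\<le>a. c s * x ^ s)" if "i < length ps" for i
    using prod_linear_factors_expansion[OF AB(1)[OF that], where f = f] AB(3)[OF that] by metis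
  then obtain c where c: "\<And>i x. i < length ps \<Longrightarrow>
      (\<Prod>y\<in>?A i. x - f y) = (\<Sum>s\<le>a. c i s * x ^ s)" by metis
  \<comment> \<open>One \<open>q\<close> has to serve every coefficient vector \<open>c\<close>,
    because it is later paired with the coefficients of all the sets \<open>?A i\<close>.\<close>
  define P where "P i q \<longleftrightarrow> (\<forall>c. (\<Prod>x\<in>?B i. \<Sum>s\<le>a. c s * f x ^ s) =
    (\<Sum>l\<in>?L. (\<Prod>s\<le>a. c s ^ (l ! s)) * q l))" for i q
  have "\<forall>i\<in>{..<length ps}. \<exists>q. P i q"
  proof
    fix i assume "i \<in> {..<length ps}"
    then have i: "i < length ps" by simp
    obtain q where "\<And>c. (\<Prod>x\<in>?B i. \<Sum>s\<le>a. c s * f x ^ s) =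
        (\<Sum>l\<in>{l. length l = Suc a \<and> sum_list l = card (?B i)}. (\<Prod>s\<le>a. c s ^ (l ! s)) * q l)"
      using prod_polynomial_values_expansion[OF AB(2)[OF i], where r = a and f = f] by blast
    then show "\<exists>q. P i q" unfolding AB(4)[OF i] P_def by blast
  qed
  from bchoice[OF this] obtain Q where "\<forall>i\<in>{..<length ps}. P i (Q i)" ..
  then have Q: "\<And>i c. i < length ps \<Longrightarrow> (\<Prod>x\<in>?B i. \<Sum>s\<le>a. c s * f x ^ s) =
      (\<Sum>l\<in>?L. (\<Prod>s\<le>a. c s ^ (l ! s)) * Q i l)"
    unfolding P_def by simp
  have M: "(\<Sum>l\<in>?L. (\<Prod>s\<le>a. c i s ^ (l ! s)) * Q j l) = 0 \<longleftrightarrow> ?A i \<inter> ?B j \<noteq> {}"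
    if "i < length ps" "j < length ps" for i j
  proof -
    have "(\<Sum>l\<in>?L. (\<Prod>s\<le>a. c i s ^ (l ! s)) * Q j l) = (\<Prod>x\<in>?B j. \<Prod>y\<in>?A i. f x - f y)"
      using that by (simp add: Q[symmetric] c)
    also have "\<dots> = 0 \<longleftrightarrow> (\<exists>x\<in>?B j. \<exists>y\<in>?A i. f x = f y)"
      using AB that by simp
    also have "\<dots> \<longleftrightarrow> ?A i \<inter> ?B j \<noteq> {}"
      using f AB(6)[OF that(1)] AB(7)[OF that(2)] by blast
    finally show ?thesis .
  qed
  \<comment> \<open>Stars and bars: \<open>a + 1\<close> naturals with sum \<open>b\<close>.\<close>
  have card: "card ?L = (a + b) choose a"
    using card_length_sum_list[of "Suc a" b] binomial_symmetric[of b "a + b"]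
    by (simp add: add.commute)
  then have "finite ?L" by (intro card_ge_0_finite) simp
  moreover have "(\<Sum>l\<in>?L. (\<Prod>s\<le>a. c i s ^ (l ! s)) * Q i l) \<noteq> 0" if "i < length ps" for i
    using M[OF that that] AB(5)[OF that] by blast
  moreover have "(\<Sum>l\<in>?L. (\<Prod>s\<le>a. c i s ^ (l ! s)) * Q j l) = 0" if "i < j" "j < length ps" for i j
    using M[of i j] that sorted_wrt_nth_less[OF skew that] by auto
  ultimately have "length ps \<le> card ?L"
    by (rule triangular_factorization_bound)
  with card show ?thesis by simp
qed

subsection \<open>The Hilton--Milner theorem\<close>

lemma finite_nsetsD: "A \<in> nsets V k \<Longrightarrow> finite A"
  by (simp add: nsets_def)

lemma card_nsets:
  assumes "finite V"
  shows "card (nsets V k) = card V choose k"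
proof -
  have "nsets V k = {A. A \<subseteq> V \<and> card A = k}"
    using assms finite_subset by (auto simp: nsets_def)
  then show ?thesis by (simp add: n_subsets[OF assms])
qed

lemma card_nsets_containing:
  assumes "finite V" "x \<in> V" "k \<ge> 1"
  shows "card {A \<in> nsets V k. x \<in> A} = (card V - 1) choose (k - 1)"
proof -
  have "{A \<in> nsets V k. x \<in> A} = insert x ` nsets (V - {x}) (k - 1)"
  proof (intro set_eqI iffI)
    fix A assume "A \<in> {A \<in> nsets V k. x \<in> A}"
    then have "A - {x} \<in> nsets (V - {x}) (k - 1)" "insert x (A - {x}) = A"
      by (auto simp: nsets_def)
    then show "A \<in> insert x ` nsets (V - {x}) (k - 1)" by (metis imageI)
  next
    fix A assume "A \<in> insert x ` nsets (V - {x}) (k - 1)"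
    then obtain B where "B \<in> nsets (V - {x}) (k - 1)" "A = insert x B" by blast
    then show "A \<in> {A \<in> nsets V k. x \<in> A}"
      using assms by (auto simp: nsets_def card_insert_if)
  qed
  moreover have "inj_on (insert x) (nsets (V - {x}) (k - 1))"
    by (intro inj_onI) (auto simp: nsets_def)
  ultimately show ?thesis
    using assms by (simp add: card_image card_nsets)
qed

text \<open>The \<open>k\<close>-sets through \<open>x\<close> that miss \<open>B\<close> are those
  through \<open>x\<close> inside \<open>V - B\<close>. The additive form avoids truncated
  subtraction.\<close>

lemma card_nsets_containing_meeting:
  assumes "finite V" "x \<in> V" "k \<ge> 1" "B \<subseteq> V" "x \<notin> B"
  shows "card {A \<in> nsets V k. x \<in> A \<and> A \<inter> B \<noteq> {}} + ((card V - card B - 1) choose (k - 1))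
    = (card V - 1) choose (k - 1)"
proof -
  have "{A \<in> nsets V k. x \<in> A} =
      {A \<in> nsets V k. x \<in> A \<and> A \<inter> B \<noteq> {}} \<union> {A \<in> nsets (V - B) k. x \<in> A}"
    by (auto simp: nsets_def)
  moreover have "card ({A \<in> nsets V k. x \<in> A \<and> A \<inter> B \<noteq> {}} \<union> {A \<in> nsets (V - B) k. x \<in> A}) =
      card {A \<in> nsets V k. x \<in> A \<and> A \<inter> B \<noteq> {}} + card {A \<in> nsets (V - B) k. x \<in> A}"
    using assms(1)
    by (intro card_Un_disjoint) (auto simp: nsets_def intro: finite_subset[OF _ finite_Pow_iff[THEN iffD2]])
  moreover have "card {A \<in> nsets (V - B) k. x \<in> A} = (card V - card B - 1) choose (k - 1)"
    using assms by (subst card_nsets_containing) (auto simp: card_Diff_subset finite_subset)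
  ultimately show ?thesis
    using card_nsets_containing[OF assms(1-3)] by simp
qed

lemma central_binomial_double:
  assumes "k \<ge> 1"
  shows "(2 * k) choose k = 2 * ((2 * k - 1) choose (k - 1))"
proof -
  obtain m where k: "k = Suc m" using assms by (cases k) auto
  have "(2 * m + 1) choose (Suc m) = (2 * m + 1) choose m"
    by (subst binomial_symmetric) auto
  then show ?thesis by (simp add: k)
qed

lemma vandermonde_pred:
  assumes "k \<ge> 1"
  shows "(\<Sum>i=1..k. (p choose (i - 1)) * (q choose (k - i))) = (p + q) choose (k - 1)"
proof -
  have "(\<Sum>i=1..k. (p choose (i - 1)) * (q choose (k - i)))
      = (\<Sum>i\<le>k - 1. (p choose i) * (q choose (k - 1 - i)))"
    using assms by (intro sum.reindex_bij_witness[of _ Suc "\<lambda>i. i - 1"]) auto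
  also have "\<dots> = (p + q) choose (k - 1)" by (rule vandermonde)
  finally show ?thesis .
qed

section \<open>Intersecting families and their traces on a 2k-set\<close>

definition intersecting :: "'a set set \<Rightarrow> bool" where
  "intersecting F \<longleftrightarrow> (\<forall>A\<in>F. \<forall>B\<in>F. A \<inter> B \<noteq> {})"

lemma intersectingD: "intersecting F \<Longrightarrow> A \<in> F \<Longrightarrow> B \<in> F \<Longrightarrow> A \<inter> B \<noteq> {}"
  by (auto simp: intersecting_def)

text \<open>\<open>G\<close> contains at most one set from each complementary pair of
  \<open>k\<close>-subsets of \<open>W\<close>.\<close>

lemma intersecting_half:
  assumes "card W = 2 * k" "k \<ge> 1" "G \<subseteq> nsets W k" "intersecting G"
  shows "card G \<le> (2 * k - 1) choose (k - 1)"
proof -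
  have fin: "finite W" using assms by (intro card_ge_0_finite) simp
  have finG: "finite G" using assms(3) finite_imp_finite_nsets[OF fin] finite_subset by blast
  have inj: "inj_on (\<lambda>A. W - A) G"
  proof (intro inj_onI)
    fix A B assume "A \<in> G" "B \<in> G" and eq: "W - A = W - B"
    then have "A \<subseteq> W" "B \<subseteq> W" using assms(3) by (auto simp: nsets_def)
    with eq show "A = B" by (metis double_diff subset_refl)
  qed
  have "G \<inter> (\<lambda>A. W - A) ` G = {}"
    using assms(4) by (auto simp: intersecting_def)
  then have "2 * card G = card (G \<union> (\<lambda>A. W - A) ` G)"
    using finG by (simp add: card_Un_disjoint card_image[OF inj])
  also have "\<dots> \<le> card (nsets W k)"
    using assms(1,3) fin
    by (intro card_mono finite_imp_finite_nsets) (auto simp: nsets_def card_Diff_subset)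
  also have "\<dots> = 2 * ((2 * k - 1) choose (k - 1))"
    using assms(1,2) fin by (simp add: card_nsets central_binomial_double)
  finally show ?thesis by simp
qed

definition traces :: "'a set set \<Rightarrow> 'a set \<Rightarrow> nat \<Rightarrow> 'a set set" where
  "traces F W i = {B \<in> (\<lambda>A. A \<inter> W) ` F. card B = i}"

text \<open>A member is determined by its trace on \<open>W\<close> together with its part outside
  \<open>W\<close>.\<close>

lemma card_le_sum_traces:
  assumes "finite V" "F \<subseteq> nsets V k" "W \<subseteq> V"
  shows "card F \<le> (\<Sum>i\<le>k. card (traces F W i) * ((card V - card W) choose (k - i)))"
proof -
  let ?S = "SIGMA i:{..k}. traces F W i \<times> nsets (V - W) (k - i)"
  have finF: "finite F" using assms finite_imp_finite_nsets finite_subset by blast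
  have fin: "finite ?S"
    using finF assms(1)
    by (intro finite_SigmaI finite_cartesian_product finite_imp_finite_nsets) (auto simp: traces_def)
  have "inj_on (\<lambda>A. (card (A \<inter> W), A \<inter> W, A - W)) F"
    by (intro inj_onI) auto
  moreover have "(\<lambda>A. (card (A \<inter> W), A \<inter> W, A - W)) ` F \<subseteq> ?S"
  proof (intro image_subsetI)
    fix A assume A: "A \<in> F"
    then have A': "A \<subseteq> V" "finite A" "card A = k" using assms(2) by (auto simp: nsets_def)
    then have "card (A \<inter> W) + card (A - W) = k"
      by (metis card_Int_Diff)
    then show "(card (A \<inter> W), A \<inter> W, A - W) \<in> ?S"
      using A A' by (auto simp: traces_def nsets_def)
  qed
  ultimately have "card F \<le> card ?S"
    using fin by (rule card_inj_on_le)
  also have "\<dots> = (\<Sum>i\<le>k. card (traces F W i) * ((card V - card W) choose (k - i)))"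
  proof -
    have "card (nsets (V - W) (k - i)) = (card V - card W) choose (k - i)" for i
      using assms card_Diff_subset[OF finite_subset[OF assms(3,1)] assms(3)] by (simp add: card_nsets)
    moreover have "finite (traces F W i \<times> nsets (V - W) (k - i))" for i
      using finF assms(1)
      by (intro finite_cartesian_product finite_imp_finite_nsets) (auto simp: traces_def)
    ultimately show ?thesis
      by (subst card_SigmaI) (simp_all add: card_cartesian_product)
  qed
  finally show ?thesis .
qed


text \<open>Vandermonde splits both binomials of the bound by the size \<open>i\<close> of the trace
  on \<open>W\<close>. It therefore suffices to bound the number of traces of size
  \<open>i < k\<close> by \<open>((2 * k - 1) choose (i - 1)) - ((k - 1) choose (i - 1))\<close> and
  those of size \<open>k\<close> by \<open>(2 * k - 1) choose (k - 1)\<close>. Traces of size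
  \<open>i < k\<close> either lie in a star and are blocked by a member avoiding its centre, or fall
  under the induction hypothesis on the ground set \<open>W\<close>.\<close>

lemma hilton_milner_core:
  fixes V W :: "'a set"
  assumes IH: "\<And>i F. 2 \<le> i \<Longrightarrow> i < k \<Longrightarrow> F \<subseteq> nsets W i \<Longrightarrow> intersecting F \<Longrightarrow>
      (\<forall>x\<in>W. \<exists>A\<in>F. x \<notin> A) \<Longrightarrow>
      card F + ((card W - i - 1) choose (i - 1)) \<le> ((card W - 1) choose (i - 1)) + 1"
    and V: "finite V" "W \<subseteq> V" "card W = 2 * k" "k \<ge> 2"
    and F: "F \<subseteq> nsets V k"
    and meet: "\<And>A B. A \<in> F \<Longrightarrow> B \<in> F \<Longrightarrow> A \<inter> B \<inter> W \<noteq> {}"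
    and avoid: "\<And>x. x \<in> W \<Longrightarrow> \<exists>A\<in>F. A \<subseteq> W \<and> x \<notin> A"
  shows "card F + ((card V - k - 1) choose (k - 1)) \<le> ((card V - 1) choose (k - 1)) + 1"
proof -
  define q where "q = card V - 2 * k"
  have cV: "card V = 2 * k + q" using card_mono[OF V(1,2)] V(3) by (simp add: q_def)
  have finW: "finite W" using V finite_subset by blast
  have FW: "A \<inter> W \<in> nsets W (card (A \<inter> W))" for A
    using finW by (simp add: nsets_def)
  have tr: "traces F W i \<subseteq> nsets W i" for i
    using FW by (auto simp: traces_def)
  have int: "intersecting (traces F W i)" for i
    using meet by (fastforce simp: traces_def intersecting_def)
  have zero: "traces F W 0 = {}"
  proof -
    have "card (A \<inter> W) \<noteq> 0" if "A \<in> F" for A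
      using meet[OF that that] finW by simp
    then show ?thesis by (auto simp: traces_def)
  qed
  have top: "card (traces F W k) \<le> (2 * k - 1) choose (k - 1)"
    using V by (intro intersecting_half[OF _ _ tr int]) auto
  have mid: "card (traces F W i) + ((k - 1) choose (i - 1)) \<le> (2 * k - 1) choose (i - 1)"
    if i: "1 \<le> i" "i < k" for i
  proof (cases "\<forall>x\<in>W. \<exists>A\<in>traces F W i. x \<notin> A")
    case False
    then obtain x where x: "x \<in> W" "\<And>A. A \<in> traces F W i \<Longrightarrow> x \<in> A" by blast
    \<comment> \<open>Since \<open>B\<close> lies inside \<open>W\<close>, all its \<open>k\<close>
      elements count when traces are required to meet it, which yields the subtracted
      \<open>(k - 1) choose (i - 1)\<close>.\<close>
    obtain B where B: "B \<in> F" "B \<subseteq> W" "x \<notin> B" using avoid[OF x(1)] by blast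
    have cB: "card B = k" using B F by (auto simp: nsets_def)
    have "traces F W i \<subseteq> {A \<in> nsets W i. x \<in> A \<and> A \<inter> B \<noteq> {}}"
      using tr x(2) meet[OF _ B(1)] by (fastforce simp: traces_def)
    then have "card (traces F W i) \<le> card {A \<in> nsets W i. x \<in> A \<and> A \<inter> B \<noteq> {}}"
      using finite_imp_finite_nsets[OF finW] by (intro card_mono) auto
    then show ?thesis
      using card_nsets_containing_meeting[OF finW x(1) i(1) B(2,3)] cB V(3) by simp
  next
    case True
    have "i \<noteq> 1"
    proof
      assume 1: "i = 1"
      have "W \<noteq> {}" using V by auto
      with True obtain A where A: "A \<in> traces F W i" by blast
      then obtain y where y: "A = {y}" "y \<in> W"
        using 1 by (auto simp: traces_def card_1_singleton_iff)
      from True y(2) obtain B where "B \<in> traces F W i" "y \<notin> B" by blast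
      with A y int[of i] show False by (auto simp: intersecting_def)
    qed
    then have i2: "2 \<le> i" using i by simp
    have "card (traces F W i) + ((2 * k - i - 1) choose (i - 1)) \<le> ((2 * k - 1) choose (i - 1)) + 1"
      using IH[OF i2 i(2) tr int True] V(3) by simp
    \<comment> \<open>As \<open>i < k\<close>, the upper index on the right is at least
      \<open>k\<close>, and one application of Pascal's rule makes room for the extra
      \<open>1\<close>.\<close>
    moreover have "((k - 1) choose (i - 1)) + 1 \<le> (2 * k - i - 1) choose (i - 1)"
    proof -
      obtain j m where j: "i = Suc (Suc j)" "k = Suc m"
        using i2 i by (metis add_2_eq_Suc le_Suc_ex less_imp_Suc_add)
      have "(m choose Suc j) + 1 \<le> (m choose Suc j) + (m choose j)"
        using i j by (simp add: Suc_le_eq)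
      also have "\<dots> = Suc m choose Suc j" by simp
      also have "\<dots> \<le> (2 * k - i - 1) choose Suc j"
        using i j by (intro binomial_right_mono) simp
      finally show ?thesis using j by simp
    qed
    ultimately show ?thesis by simp
  qed
  have range: "{..k} = insert 0 {1..k}" by auto
  have split: "{1..k} = insert k {1..<k}" using V by auto
  have "card F + ((k - 1 + q) choose (k - 1))
      \<le> (\<Sum>i=1..k. card (traces F W i) * (q choose (k - i)))
        + (\<Sum>i=1..k. ((k - 1) choose (i - 1)) * (q choose (k - i)))"
    using card_le_sum_traces[OF V(1) F V(2)] V
    by (simp add: range zero cV vandermonde_pred del: One_nat_def)
  also have "\<dots> = (\<Sum>i=1..k. (card (traces F W i) + ((k - 1) choose (i - 1))) * (q choose (k - i)))"
    by (simp add: sum.distrib distrib_right)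
  \<comment> \<open>The level \<open>i = k\<close> produces the final \<open>1\<close> of the bound,
    because \<open>(k - 1) choose (k - 1) = 1\<close>.\<close>
  also have "\<dots> = card (traces F W k) + 1 +
      (\<Sum>i=1..<k. (card (traces F W i) + ((k - 1) choose (i - 1))) * (q choose (k - i)))"
    unfolding split by simp
  also have "\<dots> \<le> ((2 * k - 1) choose (k - 1)) + 1 +
      (\<Sum>i=1..<k. ((2 * k - 1) choose (i - 1)) * (q choose (k - i)))"
    using top mid by (intro add_mono sum_mono mult_right_mono) auto
  also have "\<dots> = (\<Sum>i=1..k. ((2 * k - 1) choose (i - 1)) * (q choose (k - i))) + 1"
    unfolding split by simp
  also have "\<dots> = ((2 * k - 1 + q) choose (k - 1)) + 1"
    using V by (simp add: vandermonde_pred del: One_nat_def)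
  finally show ?thesis using V by (simp add: cV)
qed

section \<open>Shifting\<close>

definition replace :: "'a \<Rightarrow> 'a \<Rightarrow> 'a set \<Rightarrow> 'a set" where
  "replace i j A = insert i (A - {j})"

text \<open>The compression of extremal set theory. A set stays put when its image is already a
  member; this is what makes the map injective on \<open>F\<close>.\<close>

definition shift_in :: "'a \<Rightarrow> 'a \<Rightarrow> 'a set set \<Rightarrow> 'a set \<Rightarrow> 'a set" where
  "shift_in i j F A = (if j \<in> A \<and> i \<notin> A \<and> replace i j A \<notin> F then replace i j A else A)"

definition shift :: "'a \<Rightarrow> 'a \<Rightarrow> 'a set set \<Rightarrow> 'a set set" where
  "shift i j F = shift_in i j F ` F"

text \<open>Equivalent to \<open>shift i j F = F\<close>.\<close>

definition stable :: "'a \<Rightarrow> 'a \<Rightarrow> 'a set set \<Rightarrow> bool" where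
  "stable i j F \<longleftrightarrow> (\<forall>A\<in>F. j \<in> A \<longrightarrow> i \<notin> A \<longrightarrow> replace i j A \<in> F)"

lemma replace_inject:
  assumes "j \<in> A" "i \<notin> A" "j \<in> B" "i \<notin> B" "replace i j A = replace i j B"
  shows "A = B"
proof -
  have "A = insert j (replace i j A - {i})" "B = insert j (replace i j B - {i})"
    using assms(1-4) by (auto simp: replace_def)
  then show ?thesis using assms(5) by simp
qed

lemma inj_on_shift_in: "inj_on (shift_in i j F) F"
proof (intro inj_onI)
  fix A B assume AB: "A \<in> F" "B \<in> F" "shift_in i j F A = shift_in i j F B"
  then show "A = B"
    using replace_inject[of j A i B] by (auto simp: shift_in_def split: if_splits)
qed

lemma card_shift: "card (shift i j F) = card F"
  unfolding shift_def by (rule card_image[OF inj_on_shift_in])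

lemma replace_nsets:
  assumes "A \<in> nsets V k" "i \<in> V" "j \<in> A" "i \<notin> A"
  shows "replace i j A \<in> nsets V k"
proof -
  have "card (replace i j A) = card A"
    using assms card_Suc_Diff1[of A j] by (simp add: replace_def nsets_def)
  then show ?thesis using assms by (auto simp: replace_def nsets_def)
qed

lemma shift_nsets:
  assumes "F \<subseteq> nsets V k" "i \<in> V"
  shows "shift i j F \<subseteq> nsets V k"
  using assms replace_nsets[of _ V k i j] unfolding shift_def shift_in_def by (auto simp: subset_iff)

text \<open>Two moved sets share \<open>i\<close>. The delicate case is a moved \<open>A\<close>
  against a fixed \<open>B\<close>: if the image of \<open>A\<close> missed \<open>B\<close>, then
  \<open>A\<close> and \<open>B\<close> would share only \<open>j\<close>, and \<open>B\<close>
  could be fixed only because \<open>replace i j B\<close> is a member of \<open>F\<close>; but that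
  member misses \<open>A\<close>.\<close>

lemma intersecting_shift:
  assumes "intersecting F"
  shows "intersecting (shift i j F)"
proof -
  have mixed: "replace i j A \<inter> B \<noteq> {}"
    if AB: "A \<in> F" "B \<in> F" "j \<in> A" "i \<notin> A" and B: "shift_in i j F B = B" for A B
  proof
    assume empty: "replace i j A \<inter> B = {}"
    with AB intersectingD[OF assms AB(1,2)] have "A \<inter> B = {j}" "i \<notin> B"
      by (auto simp: replace_def)
    then have "replace i j B \<in> F" 
      using AB B by (auto simp: shift_in_def replace_def split: if_splits)
    moreover have "A \<inter> replace i j B = {}"
      using \<open>A \<inter> B = {j}\<close> AB by (auto simp: replace_def)
    ultimately show False using intersectingD[OF assms] AB by blast
  qed
  have "shift_in i j F A \<inter> shift_in i j F B \<noteq> {}" if "A \<in> F" "B \<in> F" for A B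
  proof (cases "shift_in i j F A = A"; cases "shift_in i j F B = B")
    assume "shift_in i j F A = A" "shift_in i j F B = B"
    then show ?thesis using intersectingD[OF assms] that by simp
  next
    assume A: "shift_in i j F A = A" and B: "shift_in i j F B \<noteq> B"
    then have "shift_in i j F B = replace i j B" "j \<in> B" "i \<notin> B"
      by (auto simp: shift_in_def split: if_splits)
    then show ?thesis using mixed[OF that(2,1) _ _ A] A by (simp add: Int_commute)
  next
    assume A: "shift_in i j F A \<noteq> A" and B: "shift_in i j F B = B"
    then have "shift_in i j F A = replace i j A" "j \<in> A" "i \<notin> A"
      by (auto simp: shift_in_def split: if_splits)
    then show ?thesis using mixed[OF that _ _ B] B by simp
  next
    assume "shift_in i j F A \<noteq> A" "shift_in i j F B \<noteq> B"
    then have "i \<in> shift_in i j F A" "i \<in> shift_in i j F B"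
      by (auto simp: shift_in_def replace_def split: if_splits)
    then show ?thesis by blast
  qed
  then show ?thesis by (auto simp: intersecting_def shift_def)
qed

text \<open>Among the families satisfying \<open>P\<close>, one minimizes the total number of
  incidences outside \<open>W\<close>. A shift into \<open>W\<close> that moves some set lowers this
  number, so it cannot preserve \<open>P\<close>.\<close>

lemma obtain_stable:
  assumes "P F\<^sub>0" and fin: "\<And>F. P F \<Longrightarrow> finite F \<and> (\<forall>A\<in>F. finite A)"
  obtains F where "P F"
    and "\<And>i j. i \<in> W \<Longrightarrow> j \<notin> W \<Longrightarrow> P (shift i j F) \<Longrightarrow> stable i j F"
proof -
  define w where "w = (\<lambda>F :: 'a set set. \<Sum>A\<in>F. card (A - W))"
  obtain F where F: "P F" "\<And>G. P G \<Longrightarrow> w F \<le> w G"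
    using ex_has_least_nat[of P F\<^sub>0 w] assms(1) by blast
  have "stable i j F" if ij: "i \<in> W" "j \<notin> W" "P (shift i j F)" for i j
  proof (rule ccontr)
    assume "\<not> stable i j F"
    then obtain A where A: "A \<in> F" "j \<in> A" "i \<notin> A" "replace i j A \<notin> F"
      by (auto simp: stable_def)
    have less: "card (replace i j B - W) < card (B - W)" if "B \<in> F" "j \<in> B" for B
    proof -
      have "replace i j B - W = (B - W) - {j}" using ij by (auto simp: replace_def)
      moreover have "finite (B - W)" using fin[OF F(1)] that by blast
      ultimately show ?thesis using that ij card_Diff1_less[of "B - W" j] by simp
    qed
    have "w (shift i j F) = (\<Sum>B\<in>F. card (shift_in i j F B - W))"
      unfolding w_def shift_def by (simp add: sum.reindex[OF inj_on_shift_in])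
    also have "\<dots> < w F"
      unfolding w_def
    proof (rule sum_strict_mono_ex1)
      show "finite F" using fin[OF F(1)] by blast
      show "\<forall>B\<in>F. card (shift_in i j F B - W) \<le> card (B - W)"
        using less by (auto simp: shift_in_def intro: less_imp_le)
      show "\<exists>B\<in>F. card (shift_in i j F B - W) < card (B - W)"
        using A less[OF A(1,2)] by (intro bexI[of _ A]) (auto simp: shift_in_def)
    qed
    finally show False using F(2)[OF ij(3)] by simp
  qed
  with F(1) show ?thesis by (rule that)
qed

text \<open>Descent on the size of \<open>A \<inter> B\<close>. If \<open>A\<close> and
  \<open>B\<close> meet only outside \<open>W\<close>, say in \<open>j\<close>, both traces have
  fewer than \<open>k\<close> elements, so some \<open>i\<close> in \<open>W\<close> lies in neither
  set, and the condition on \<open>T\<close> puts it outside \<open>T\<close>. Replacing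
  \<open>j\<close> by \<open>i\<close> in \<open>A\<close> gives a member with a smaller
  intersection with \<open>B\<close>.\<close>

lemma stable_imp_traces_meet:
  assumes F: "F \<subseteq> nsets V k" "intersecting F" and W: "finite W" "card W = 2 * k" "k \<ge> 1"
    and T: "\<And>A B. A \<in> F \<Longrightarrow> B \<in> F \<Longrightarrow> A \<inter> B \<inter> T = {} \<Longrightarrow> T \<subseteq> A \<union> B" "T \<subseteq> W"
    and stable: "\<And>i j. i \<in> W - T \<Longrightarrow> j \<in> V - W \<Longrightarrow> stable i j F"
    and AB: "A \<in> F" "B \<in> F"
  shows "A \<inter> B \<inter> W \<noteq> {}"
  using AB
proof (induction "card (A \<inter> B)" arbitrary: A rule: less_induct)
  case less
  show ?case
  proof
    assume empty: "A \<inter> B \<inter> W = {}"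
    have A: "A \<subseteq> V" "finite A" "card A = k" and B: "finite B" "card B = k"
      using less.prems F(1) by (auto simp: nsets_def)
    obtain j where j: "j \<in> A" "j \<in> B" using intersectingD[OF F(2) less.prems] by blast
    then have jW: "j \<in> V - W" using empty A by blast
    have "card (A \<inter> W) < k" "card (B \<inter> W) < k"
      using A B j jW psubset_card_mono[of A "A \<inter> W"] psubset_card_mono[of B "B \<inter> W"] by auto
    then have "card ((A \<union> B) \<inter> W) < card W"
      using card_Un_le[of "A \<inter> W" "B \<inter> W"] W(2) by (simp add: Int_Un_distrib2)
    then obtain i where i: "i \<in> W" "i \<notin> A" "i \<notin> B"
      by (metis Int_absorb1 UnI1 UnI2 less_irrefl subsetI)
    have "T \<subseteq> A \<union> B" using T empty less.prems by blast
    then have "i \<in> W - T" using i by blast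
    then have A': "replace i j A \<in> F"
      using stable[OF _ jW] i j less.prems by (auto simp: stable_def)
    have eq: "replace i j A \<inter> B = A \<inter> B - {j}" using i by (auto simp: replace_def)
    have "card (replace i j A \<inter> B) < card (A \<inter> B)"
      unfolding eq using j A by (intro card_Diff1_less) auto
    from less.hyps[OF this A' less.prems(2)] show False
      unfolding eq using empty by blast
  qed
qed

text \<open>Descent on the size of \<open>A - W\<close>, moving elements into \<open>W\<close>
  without touching \<open>x\<close>. The new element must avoid \<open>A\<close>, \<open>T\<close>
  and \<open>x\<close>; these cover at most \<open>(k - 1) + 2 < 2 * k\<close> elements of
  \<open>W\<close>, which is where \<open>k \<ge> 2\<close> enters.\<close>

lemma stable_imp_avoid:
  assumes F: "F \<subseteq> nsets V k" and W: "finite W" "card W = 2 * k" "k \<ge> 2"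
    and T: "\<And>A. A \<in> F \<Longrightarrow> card (T - A) \<le> 1" "T \<subseteq> W"
    and stable: "\<And>i j. i \<in> W - T \<Longrightarrow> j \<in> V - W \<Longrightarrow> stable i j F"
    and A: "A \<in> F" "x \<notin> A"
  shows "\<exists>B\<in>F. B \<subseteq> W \<and> x \<notin> B"
  using A
proof (induction "card (A - W)" arbitrary: A rule: less_induct)
  case less
  show ?case
  proof (cases "A \<subseteq> W")
    case True
    then show ?thesis using less.prems by blast
  next
    case False
    then obtain j where j: "j \<in> A" "j \<notin> W" by blast
    have A: "A \<subseteq> V" "finite A" "card A = k"
      using less.prems F by (auto simp: nsets_def)
    have "card (A \<inter> W) < k"
      using A j psubset_card_mono[of A "A \<inter> W"] by auto
    moreover have "card (insert x (T - A)) \<le> 2"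
      using T(1)[OF less.prems(1)] card_insert_le_m1[of 2 "T - A" x] by simp
    ultimately have "card ((A \<inter> W) \<union> insert x (T - A)) < card W"
      using card_Un_le[of "A \<inter> W" "insert x (T - A)"] W by simp
    moreover have "finite ((A \<inter> W) \<union> insert x (T - A))"
      using A finite_subset[OF T(2) W(1)] by simp
    ultimately have "\<not> W \<subseteq> (A \<inter> W) \<union> insert x (T - A)"
      using card_mono by (metis leD)
    then obtain i where i: "i \<in> W" "i \<notin> A" "i \<notin> T" "i \<noteq> x" by blast
    have A': "replace i j A \<in> F" "x \<notin> replace i j A"
      using stable[of i j] i j less.prems A by (auto simp: stable_def replace_def)
    have eq: "replace i j A - W = A - W - {j}" using i by (auto simp: replace_def)
    have "card (replace i j A - W) < card (A - W)"
      unfolding eq using j A by (intro card_Diff1_less) auto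
    from less.hyps[OF this A'] show ?thesis .
  qed
qed

section \<open>Induction on k for the Hilton--Milner bound\<close>

lemma obtain_superset_card:
  assumes "finite V" "T \<subseteq> V" "card T \<le> m" "m \<le> card V"
  obtains W where "T \<subseteq> W" "W \<subseteq> V" "card W = m" "finite W"
proof -
  obtain W where "T \<subseteq> W" "W \<subseteq> V" "card W = m"
    using exists_subset_between[OF assms(3,4,2,1)] by blast
  then show ?thesis using that finite_subset[OF _ assms(1)] by blast
qed

text \<open>If a shift turns a nontrivial family into a subfamily of a star, then all its members meet a
  pair \<open>T\<close>. Adding all supersets of \<open>T\<close> makes shifts outside \<open>T\<close> preserve nontriviality.\<close>

theorem hilton_milner:
  fixes V :: "'a set"
  assumes "finite V" "2 * k \<le> card V" "k \<ge> 2" "F \<subseteq> nsets V k" "intersecting F"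
    and "\<forall>x\<in>V. \<exists>A\<in>F. x \<notin> A"
  shows "card F + ((card V - k - 1) choose (k - 1)) \<le> ((card V - 1) choose (k - 1)) + 1"
  using assms
proof (induction k arbitrary: V F rule: less_induct)
  case (less k)
  note V = less.prems(1-3)
  \<comment> \<open>\<open>T\<close> will be either empty or a pair that every member of
    \<open>G\<close> meets; both conditions on \<open>T\<close> hold trivially in the first
    case.\<close>
  have core: "card G + ((card V - k - 1) choose (k - 1)) \<le> ((card V - 1) choose (k - 1)) + 1"
    if G: "G \<subseteq> nsets V k" "intersecting G" "\<forall>x\<in>V. \<exists>A\<in>G. x \<notin> A"
      and W: "W \<subseteq> V" "card W = 2 * k"
      and T: "T \<subseteq> W" "\<And>A. A \<in> G \<Longrightarrow> card (T - A) \<le> 1"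
        "\<And>A B. A \<in> G \<Longrightarrow> B \<in> G \<Longrightarrow> A \<inter> B \<inter> T = {} \<Longrightarrow> T \<subseteq> A \<union> B"
      and stable: "\<And>i j. i \<in> W - T \<Longrightarrow> j \<in> V - W \<Longrightarrow> stable i j G"
    for G W T
  proof (rule hilton_milner_core[OF _ V(1) W V(3) G(1)])
    have finW: "finite W" using W V finite_subset by blast
    show "card H + ((card W - i - 1) choose (i - 1)) \<le> ((card W - 1) choose (i - 1)) + 1"
      if "2 \<le> i" "i < k" "H \<subseteq> nsets W i" "intersecting H" "\<forall>x\<in>W. \<exists>A\<in>H. x \<notin> A" for i H
      using less.IH[OF that(2) finW _ that(1,3,4,5)] that(2) W(2) by simp
    show "A \<inter> B \<inter> W \<noteq> {}" if "A \<in> G" "B \<in> G" for A B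
      using V(3) by (intro stable_imp_traces_meet[OF G(1,2) finW W(2) _ T(3,1) stable that]) auto
    show "\<exists>A\<in>G. A \<subseteq> W \<and> x \<notin> A" if "x \<in> W" for x
    proof -
      obtain A where "A \<in> G" "x \<notin> A" using G(3) \<open>x \<in> W\<close> W(1) by blast
      then show ?thesis
        using stable_imp_avoid[OF G(1) finW W(2) V(3) T(2,1) stable] by blast
    qed
  qed
  have fin: "finite G \<and> (\<forall>A\<in>G. finite A)" if "G \<subseteq> nsets V k" for G
    using that finite_subset[OF that finite_imp_finite_nsets[OF V(1)]] finite_nsetsD by blast
  have pair: "card G + ((card V - k - 1) choose (k - 1)) \<le> ((card V - 1) choose (k - 1)) + 1"
    if G: "G \<subseteq> nsets V k" "intersecting G" "\<forall>x\<in>V. \<exists>A\<in>G. x \<notin> A"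
      and ab: "a \<in> V" "b \<in> V" "a \<noteq> b" and meet: "\<And>A. A \<in> G \<Longrightarrow> a \<in> A \<or> b \<in> A"
    for G a b
  proof -
    define T where "T = {a, b}"
    obtain W where W: "T \<subseteq> W" "W \<subseteq> V" "card W = 2 * k" "finite W"
      using obtain_superset_card[OF V(1), of T "2 * k"] V ab by (auto simp: T_def)
    define S where "S = {A \<in> nsets V k. T \<subseteq> A}"
    \<comment> \<open>With \<open>S\<close> inside \<open>H\<close>, every point outside
      \<open>T\<close> is avoided automatically, so nontriviality needs to be tracked only at
      \<open>a\<close> and \<open>b\<close>.\<close>
    define P where "P H \<longleftrightarrow> H \<subseteq> nsets V k \<and> intersecting H \<and> (\<forall>A\<in>H. a \<in> A \<or> b \<in> A) \<and>
      (\<exists>A\<in>H. a \<notin> A) \<and> (\<exists>A\<in>H. b \<notin> A) \<and> S \<subseteq> H \<and> card H = card (G \<union> S)" for H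
    have "P (G \<union> S)"
    proof -
      have GS: "a \<in> A \<or> b \<in> A" if "A \<in> G \<union> S" for A
        using meet that by (auto simp: S_def T_def)
      have "A \<inter> B \<noteq> {}" if AB: "A \<in> G \<union> S" "B \<in> G \<union> S" for A B
      proof (cases "A \<in> G \<and> B \<in> G")
        case True
        then show ?thesis using intersectingD[OF G(2)] by blast
      next
        case False
        then have "T \<subseteq> A \<or> T \<subseteq> B" using AB by (auto simp: S_def)
        then show ?thesis using GS[OF AB(1)] GS[OF AB(2)] by (auto simp: T_def)
      qed
      moreover have "G \<union> S \<subseteq> nsets V k" using G(1) by (auto simp: S_def)
      moreover have "\<exists>A\<in>G \<union> S. a \<notin> A" "\<exists>A\<in>G \<union> S. b \<notin> A" using G(3) ab by blast+
      ultimately show ?thesis using GS by (simp add: P_def intersecting_def)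
    qed
    then obtain H where H: "P H"
      "\<And>i j. i \<in> W \<Longrightarrow> j \<notin> W \<Longrightarrow> P (shift i j H) \<Longrightarrow> stable i j H"
      by (rule obtain_stable[of P _ W]) (auto simp: P_def fin)
    have stable: "stable i j H" if ij: "i \<in> W - T" "j \<in> V - W" for i j
    proof -
      have T: "a \<in> shift_in i j H A \<longleftrightarrow> a \<in> A" "b \<in> shift_in i j H A \<longleftrightarrow> b \<in> A" for A
        using ij W(1) by (auto simp: shift_in_def replace_def T_def)
      have H1: "H \<subseteq> nsets V k" "intersecting H" "\<forall>A\<in>H. a \<in> A \<or> b \<in> A" "\<exists>A\<in>H. a \<notin> A"
        "\<exists>A\<in>H. b \<notin> A" "S \<subseteq> H" "card H = card (G \<union> S)"
        using H(1) by (auto simp: P_def)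
      \<comment> \<open>Neither \<open>i\<close> nor \<open>j\<close> lies in \<open>T\<close>, so
        the image of a set from \<open>S\<close> is again in \<open>S\<close>, hence already in
        \<open>H\<close>.\<close>
      have "shift_in i j H A = A" if "A \<in> S" for A
      proof -
        have "replace i j A \<in> S" if "j \<in> A" "i \<notin> A"
          using replace_nsets[of A V k i j] that \<open>A \<in> S\<close> ij W by (auto simp: S_def replace_def)
        then show ?thesis using H1(6) by (auto simp: shift_in_def)
      qed
      then have "shift_in i j H ` S = S" by force
      then have "S \<subseteq> shift i j H"
        using image_mono[OF H1(6), of "shift_in i j H"] by (simp add: shift_def)
      moreover have "i \<in> V" using ij W by blast
      ultimately have "P (shift i j H)"
        using H1 T shift_nsets[OF H1(1)] intersecting_shift[OF H1(2)] card_shift[of i j H]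
        unfolding P_def by (simp add: shift_def)
      then show ?thesis using H(2) ij by blast
    qed
    have Hab: "a \<in> A \<or> b \<in> A" if "A \<in> H" for A using H(1) that by (auto simp: P_def)
    have "\<forall>x\<in>V. \<exists>A\<in>H. x \<notin> A"
    proof
      fix x assume x: "x \<in> V"
      show "\<exists>A\<in>H. x \<notin> A"
      proof (cases "x \<in> T")
        case True
        then show ?thesis using H(1) by (auto simp: T_def P_def)
      next
        case False
        have "T \<subseteq> V - {x}" "card T \<le> k" "k \<le> card (V - {x})"
          using False ab V x by (auto simp: T_def)
        from obtain_superset_card[OF _ this] V(1) obtain A where
          "T \<subseteq> A" "A \<subseteq> V - {x}" "card A = k" "finite A" by auto
        then have "A \<in> S" "x \<notin> A" by (auto simp: S_def nsets_def)
        then show ?thesis using H(1) by (auto simp: P_def)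
      qed
    qed
    moreover have "card (T - A) \<le> 1" if "A \<in> H" for A
    proof -
      have "T - A \<subseteq> {a} \<or> T - A \<subseteq> {b}" using Hab[OF that] by (auto simp: T_def)
      then show ?thesis using card_mono[of "{a}" "T - A"] card_mono[of "{b}" "T - A"] by auto
    qed
    moreover have "T \<subseteq> A \<union> B" if "A \<in> H" "B \<in> H" "A \<inter> B \<inter> T = {}" for A B
      using Hab[OF that(1)] Hab[OF that(2)] that(3) by (auto simp: T_def)
    ultimately have "card H + ((card V - k - 1) choose (k - 1)) \<le> ((card V - 1) choose (k - 1)) + 1"
      using H(1) by (intro core[of H W T] W stable) (auto simp: P_def)
    moreover have "card G \<le> card H"
    proof -
      have "card H = card (G \<union> S)" using H(1) by (simp add: P_def)
      moreover have "finite (G \<union> S)"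
        using fin[OF G(1)] finite_imp_finite_nsets[OF V(1)] by (simp add: S_def)
      ultimately show ?thesis by (simp add: card_mono)
    qed
    ultimately show ?thesis by simp
  qed
  define P where "P G \<longleftrightarrow> G \<subseteq> nsets V k \<and> intersecting G \<and> (\<forall>x\<in>V. \<exists>A\<in>G. x \<notin> A) \<and> card G = card F" for G
  obtain W where W: "W \<subseteq> V" "card W = 2 * k"
    using obtain_superset_card[OF V(1), of "{}" "2 * k"] V by auto
  have "P F" using less.prems by (simp add: P_def)
  then obtain G where G: "P G"
    "\<And>i j. i \<in> W \<Longrightarrow> j \<notin> W \<Longrightarrow> P (shift i j G) \<Longrightarrow> stable i j G"
    by (rule obtain_stable[of P _ W]) (auto simp: P_def fin)
  have cG: "card G = card F" and G1: "G \<subseteq> nsets V k" "intersecting G" "\<forall>x\<in>V. \<exists>A\<in>G. x \<notin> A"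
    using G(1) by (auto simp: P_def)
  show ?case
  proof (cases "\<forall>i\<in>W. \<forall>j\<in>V - W. P (shift i j G)")
    case True
    then show ?thesis
      using core[OF G1 W, of "{}"] G(2) cG by auto
  next
    case False
    then obtain i j where ij: "i \<in> W" "j \<in> V - W" "\<not> P (shift i j G)" by blast
    have iV: "i \<in> V" using ij W by blast
    \<comment> \<open>Shifting preserves size, uniformity and intersection, so only nontriviality
      can have failed: all shifted sets share a point \<open>x\<close>. Some member of
      \<open>G\<close> avoids \<open>x\<close>, which forces \<open>x = i\<close>, and before the
      shift every member contained \<open>i\<close> or \<open>j\<close>.\<close>
    have "\<not> (\<forall>x\<in>V. \<exists>A\<in>shift i j G. x \<notin> A)"
      using ij(3) shift_nsets[OF G1(1) iV] intersecting_shift[OF G1(2)] card_shift[of i j G] cG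
      by (auto simp: P_def)
    then obtain x where x: "x \<in> V" "\<And>A. A \<in> G \<Longrightarrow> x \<in> shift_in i j G A"
      by (auto simp: shift_def)
    obtain A where "A \<in> G" "x \<notin> A" using G1(3) x(1) by blast
    then have "x = i"
      using x(2)[of A] by (auto simp: shift_in_def replace_def split: if_splits)
    then have "i \<in> A \<or> j \<in> A" if "A \<in> G" for A
      using x(2)[OF that] by (auto simp: shift_in_def split: if_splits)
    then show ?thesis
      using pair[OF G1, of i j] iV ij cG by auto
  qed
qed

subsection \<open>Union intersecting families\<close>

text \<open>Each round keeps \<open>A\<close>, which meets every surviving set, and loses only the
  at most \<open>d\<close> members disjoint from it. Later pairs consist of survivors, so both of
  their sets meet \<open>A\<close>; this is the condition on the order of \<open>ps\<close>.\<close>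

lemma exists_intersecting_subfamily_pairs:
  assumes "finite F" "{} \<notin> F" "\<And>A. A \<in> F \<Longrightarrow> card {B \<in> F. A \<inter> B = {}} \<le> d"
  shows "\<exists>F' ps. F' \<subseteq> F \<and> intersecting F' \<and> set ps \<subseteq> F \<times> F \<and>
    (\<forall>p\<in>set ps. fst p \<inter> snd p = {}) \<and>
    sorted_wrt (\<lambda>p q. fst p \<inter> fst q \<noteq> {} \<and> fst p \<inter> snd q \<noteq> {}) ps \<and>
    card (F - F') \<le> d * length ps"
  using assms
proof (induction F rule: finite_psubset_induct)
  case (psubset F)
  show ?case
  proof (cases "intersecting F")
    case True
    then show ?thesis by (intro exI[of _ F] exI[of _ "[]"]) auto
  next
    case False
    then obtain A B where AB: "A \<in> F" "B \<in> F" "A \<inter> B = {}" by (auto simp: intersecting_def)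
    define N where "N = {C \<in> F. A \<inter> C = {}}"
    define G where "G = F - N - {A}"
    have G: "G \<subset> F" using AB by (auto simp: G_def)
    have "card {C \<in> G. D \<inter> C = {}} \<le> d" if "D \<in> G" for D
    proof -
      have "card {C \<in> G. D \<inter> C = {}} \<le> card {C \<in> F. D \<inter> C = {}}"
        using G psubset.hyps by (intro card_mono) auto
      also have "\<dots> \<le> d" using psubset.prems(2) G that by blast
      finally show ?thesis .
    qed
    from psubset.IH[OF G _ this] psubset.prems(1) G obtain F' ps where
      F': "F' \<subseteq> G" "intersecting F'" "set ps \<subseteq> G \<times> G"
        "\<forall>p\<in>set ps. fst p \<inter> snd p = {}"
        "sorted_wrt (\<lambda>p q. fst p \<inter> fst q \<noteq> {} \<and> fst p \<inter> snd q \<noteq> {}) ps"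
        "card (G - F') \<le> d * length ps" by blast
    have A_G: "A \<inter> C \<noteq> {}" if "C \<in> G" for C using that by (auto simp: G_def N_def)
    have "A \<noteq> {}" using psubset.prems(1) AB by blast
    then have "intersecting (insert A F')"
      using F'(1,2) A_G unfolding intersecting_def by (metis Int_commute Int_absorb insertE subsetD)
    moreover have "sorted_wrt (\<lambda>p q. fst p \<inter> fst q \<noteq> {} \<and> fst p \<inter> snd q \<noteq> {}) ((A, B) # ps)"
      using F'(3,5) A_G by auto
    moreover have "card (F - insert A F') \<le> d * length ((A, B) # ps)"
    proof -
      have "F - insert A F' \<subseteq> N \<union> (G - F')" by (auto simp: G_def)
      moreover have "finite (N \<union> (G - F'))" using psubset.hyps by (auto simp: N_def G_def)
      ultimately have "card (F - insert A F') \<le> card (N \<union> (G - F'))" by (rule card_mono[rotated])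
      also have "\<dots> \<le> card N + card (G - F')" by (rule card_Un_le)
      also have "\<dots> \<le> d + d * length ps"
        using F'(6) psubset.prems(2)[OF AB(1)] by (intro add_mono) (simp_all add: N_def)
      finally show ?thesis by simp
    qed
    moreover have "insert A F' \<subseteq> F" "set ((A, B) # ps) \<subseteq> F \<times> F" "\<forall>p\<in>set ((A, B) # ps). fst p \<inter> snd p = {}"
      using F' G AB by auto
    ultimately show ?thesis by blast
  qed
qed

text \<open>Following the pairs \<open>(A, B)\<close> by the reversed list of the pairs \<open>(B, A)\<close> keeps the
  system skew, which gains a factor 2 over a direct application of \<open>skew_bollobas\<close>.\<close>

lemma exists_large_intersecting_subfamily:
  assumes "finite F" "\<And>A. A \<in> F \<Longrightarrow> finite A \<and> card A = k" "k \<ge> 1"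
    and "\<And>A. A \<in> F \<Longrightarrow> card {B \<in> F. A \<inter> B = {}} \<le> d"
  obtains F' where "F' \<subseteq> F" "intersecting F'" "card (F - F') \<le> d * ((2 * k - 1) choose (k - 1))"
proof -
  have "{} \<notin> F" using assms(2,3) by fastforce
  from exists_intersecting_subfamily_pairs[OF assms(1) this assms(4)] obtain F' ps where
    F': "F' \<subseteq> F" "intersecting F'" "set ps \<subseteq> F \<times> F" "\<forall>p\<in>set ps. fst p \<inter> snd p = {}"
      "sorted_wrt (\<lambda>p q. fst p \<inter> fst q \<noteq> {} \<and> fst p \<inter> snd q \<noteq> {}) ps"
      "card (F - F') \<le> d * length ps" by blast
  \<comment> \<open>In \<open>?qs\<close> a pair \<open>(A, B)\<close> of \<open>ps\<close> precedes
    every swapped pair \<open>(B', A')\<close>, so skewness demands that \<open>A\<close> meets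
    \<open>A'\<close>, including the case \<open>A = A'\<close>.\<close>
  have fst_fst: "fst p \<inter> fst q \<noteq> {}" if pq: "p \<in> set ps" "q \<in> set ps" for p q
  proof -
    obtain i j where ij: "i < length ps" "j < length ps" "p = ps ! i" "q = ps ! j"
      using pq by (auto simp: in_set_conv_nth)
    consider "i < j" | "j < i" | "p = q" using ij by (metis linorder_neqE_nat)
    then show ?thesis
    proof cases
      case 1
      then show ?thesis using sorted_wrt_nth_less[OF F'(5) 1] ij by simp
    next
      case 2
      then show ?thesis using sorted_wrt_nth_less[OF F'(5) 2] ij by (simp add: Int_commute)
    next
      case 3
      then show ?thesis using F'(3) pq(1) \<open>{} \<notin> F\<close> by (cases p) auto
    qed
  qed
  let ?qs = "ps @ rev (map prod.swap ps)"
  have "sorted_wrt (\<lambda>p q. fst p \<inter> snd q \<noteq> {}) ps"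
    by (rule sorted_wrt_mono_rel[OF _ F'(5)]) blast
  \<comment> \<open>After the reversal the swap of a later \<open>q\<close> comes before the swap of
    an earlier \<open>p\<close>, so skewness of the second half takes this form.\<close>
  moreover have "sorted_wrt (\<lambda>p q. snd q \<inter> fst p \<noteq> {}) ps"
    by (rule sorted_wrt_mono_rel[OF _ F'(5)]) blast
  ultimately have "sorted_wrt (\<lambda>p q. fst p \<inter> snd q \<noteq> {}) ?qs"
    using fst_fst by (simp add: sorted_wrt_append sorted_wrt_rev sorted_wrt_map)
  moreover have "finite A \<and> finite B \<and> card A = k \<and> card B = k \<and> A \<inter> B = {}"
    if "(A, B) \<in> set ?qs" for A B
  proof -
    have "(A, B) \<in> set ps \<or> (B, A) \<in> set ps" using that by auto
    then have "A \<in> F" "B \<in> F" "A \<inter> B = {}" using F'(3,4) by fastforce+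
    then show ?thesis using assms(2) by simp
  qed
  ultimately have "length ?qs \<le> (k + k) choose k" by (rule skew_bollobas)
  \<comment> \<open>The doubled length of \<open>?qs\<close> cancels the factor 2 in
    \<open>central_binomial_double\<close>.\<close>
  then have "length ps \<le> (2 * k - 1) choose (k - 1)"
    using central_binomial_double[OF assms(3)] by (simp flip: mult_2)
  then have "card (F - F') \<le> d * ((2 * k - 1) choose (k - 1))"
    using F'(6) by (meson le_trans mult_le_mono2)
  with F'(1,2) show ?thesis by (rule that)
qed

lemma one_union_intersecting_few_disjoint:
  assumes "one_union_intersecting t F" "finite F" "A \<in> F" "t \<ge> 1"
  shows "card {B \<in> F. A \<inter> B = {}} \<le> t - 1"
proof (rule ccontr)
  assume "\<not> ?thesis"
  then have "t \<le> card {B \<in> F. A \<inter> B = {}}" using assms(4) by simp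
  then obtain \<B> where "\<B> \<subseteq> {B \<in> F. A \<inter> B = {}}" "card \<B> = t" "finite \<B>"
    by (rule obtain_subset_with_card_n)
  then have "\<B> \<in> nsets F t" "A \<inter> \<Union>\<B> = {}" by (auto simp: nsets_def)
  with assms(1,3) show False by (auto simp: one_union_intersecting_def)
qed

text \<open>For \<open>2 * k \<le> card V\<close>, deleting at most \<open>(t - 1) * C\<close>
  members leaves an intersecting \<open>F'\<close>. It exceeds the difference of the two binomials
  by at most \<open>1\<close> (Hilton--Milner) or \<open>t - 1\<close> (inside a star), and both are
  less than \<open>t\<close>.\<close>

theorem one_union_intersecting_subset_star:
  assumes V: "finite V" "V \<noteq> {}" and kt: "k \<ge> 2" "t \<ge> 2"
    and F: "F \<subseteq> nsets V k" "one_union_intersecting t F"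
    and large: "card F + ((card V - k - 1) choose (k - 1)) \<ge>
      ((card V - 1) choose (k - 1)) + (t - 1) * ((2 * k - 1) choose (k - 1)) + t"
  shows "\<exists>x\<in>V. \<forall>A\<in>F. x \<in> A"
proof (rule ccontr)
  assume nontrivial: "\<not> ?thesis"
  define C where "C = (2 * k - 1) choose (k - 1)"
  have finF: "finite F" using F(1) finite_imp_finite_nsets[OF V(1)] finite_subset by blast
  have deg: "card {B \<in> F. A \<inter> B = {}} \<le> t - 1" if "A \<in> F" for A
    using one_union_intersecting_few_disjoint[OF F(2) finF that] kt by simp
  show False
  proof (cases "2 * k \<le> card V")
    case False
    obtain m where m: "card V = Suc m" using V by (metis card_0_eq not0_implies_Suc)
    obtain l where l: "k = Suc l" using kt by (cases k) auto
    \<comment> \<open>Below the range of Hilton--Milner, already the number of all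
      \<open>k\<close>-subsets of \<open>V\<close> is too small for the assumed size.\<close>
    have "card F \<le> card V choose k"
      using card_mono[OF finite_imp_finite_nsets[OF V(1)] F(1)] V(1) by (simp add: card_nsets)
    also have "\<dots> = ((card V - 1) choose (k - 1)) + ((card V - 1) choose k)"
      using m l by simp
    also have "(card V - 1) choose k \<le> (2 * k - 1) choose k"
      using False by (intro binomial_right_mono) simp
    also have "(2 * k - 1) choose k = C"
      using kt binomial_symmetric[of k "2 * k - 1"] by (simp add: C_def)
    also have "C \<le> (t - 1) * C" using kt by (cases "t - 1") auto
    finally have "card F \<le> ((card V - 1) choose (k - 1)) + (t - 1) * C" by simp
    moreover have "(card V - k - 1) choose (k - 1) = 0"
      using False kt by (intro binomial_eq_0) simp
    ultimately show False using large kt unfolding C_def by linarith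
  next
    case True
    obtain F' where F': "F' \<subseteq> F" "intersecting F'" "card (F - F') \<le> (t - 1) * C"
      using exists_large_intersecting_subfamily[OF finF _ _ deg, of k] F(1) kt
      by (auto simp: nsets_def C_def subset_iff)
    have card_F: "card F \<le> card F' + (t - 1) * C"
      using F'(1,3) finF by (simp add: card_Diff_subset finite_subset)
    show False
    proof (cases "\<forall>x\<in>V. \<exists>A\<in>F'. x \<notin> A")
      case True
      have "card F' + ((card V - k - 1) choose (k - 1)) \<le> ((card V - 1) choose (k - 1)) + 1"
        using hilton_milner[OF V(1) \<open>2 * k \<le> card V\<close> kt(1) _ F'(2) True] F'(1) F(1) by blast
      then show False using card_F large kt unfolding C_def by linarith
    next
      case False
      then obtain x where x: "x \<in> V" "\<And>A. A \<in> F' \<Longrightarrow> x \<in> A" by blast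
      obtain B where B: "B \<in> F" "x \<notin> B" using nontrivial x(1) by blast
      have B': "B \<subseteq> V" "card B = k" using B(1) F(1) by (auto simp: nsets_def)
      let ?S = "{A \<in> nsets V k. x \<in> A \<and> A \<inter> B \<noteq> {}}" and ?N = "{A \<in> F. B \<inter> A = {}}"
      \<comment> \<open>Members of \<open>F'\<close> contain \<open>x\<close>; those that do not
        meet \<open>B\<close> are among the at most \<open>t - 1\<close> members of \<open>F\<close>
        disjoint from \<open>B\<close>.\<close>
      have "card F' \<le> card (?S \<union> ?N)"
        using F'(1) F(1) x(2) finF finite_imp_finite_nsets[OF V(1)] by (intro card_mono) auto
      also have "\<dots> \<le> card ?S + card ?N" by (rule card_Un_le)
      finally have "card F' \<le> card ?S + (t - 1)" using deg[OF B(1)] by simp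
      moreover have "card ?S + ((card V - k - 1) choose (k - 1)) = (card V - 1) choose (k - 1)"
        using card_nsets_containing_meeting[OF V(1) x(1) _ B'(1) B(2), of k] kt B'(2) by simp
      ultimately show False using card_F large kt unfolding C_def by linarith
    qed
  qed
qed

subsection \<open>The threshold for \<open>n\<close>\<close>

text \<open>The factors with indices \<open>i\<close> and \<open>m - 1 - i\<close> are paired: around the common centres \<open>c\<close> and
  \<open>e\<close> they become \<open>c\<^sup>2 - d\<^sup>2 \<ge> y\<^sup>2 (e\<^sup>2 - d\<^sup>2)\<close>.\<close>

lemma binomial_ratio_lower_bound:
  fixes y :: real
  assumes y: "y \<ge> 1" and m: "m \<le> M" "m \<le> N"
    and centre: "real N - (real m - 1) / 2 \<ge> y * (real M - (real m - 1) / 2)"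
  shows "y ^ m * real (M choose m) \<le> real (N choose m)"
proof -
  define P where "P L = (\<Prod>i<m. real L - real i)" for L :: nat
  have choose: "real (L choose m) = P L / fact m" for L
    unfolding binomial_gbinomial gbinomial_prod_rev P_def by (simp add: atLeast0LessThan)
  \<comment> \<open>The product is multiplied by its own reversal, which creates the symmetric pairs
    of factors.\<close>
  have P_sq: "P L ^ 2 = (\<Prod>i<m. (real L - real i) * (real L - real (m - Suc i)))" for L
    unfolding P_def power2_eq_square prod.distrib
    by (simp only: prod.nat_diff_reindex[of "\<lambda>i. real L - real i" m])
  have P_nonneg: "0 \<le> P L" if "m \<le> L" for L
    unfolding P_def using that by (intro prod_nonneg) auto
  have "(y ^ m * P M) ^ 2 = (\<Prod>i<m. y\<^sup>2 * ((real M - real i) * (real M - real (m - Suc i))))"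
    by (simp add: power_mult_distrib P_sq prod.distrib flip: power_mult) (simp add: mult.commute)
  also have "\<dots> \<le> (\<Prod>i<m. (real N - real i) * (real N - real (m - Suc i)))"
  proof (rule prod_mono)
    fix i assume "i \<in> {..<m}"
    then have i: "i < m" by simp
    \<comment> \<open>The paired factors are \<open>c + d\<close>, \<open>c - d\<close> and
      \<open>e + d\<close>, \<open>e - d\<close>.\<close>
    define c e d where "c = real N - (real m - 1) / 2" and "e = real M - (real m - 1) / 2"
      and "d = (real m - 1) / 2 - real i"
    have mi: "real (m - Suc i) = real m - 1 - real i" using i by (simp add: of_nat_diff)
    have eqs: "(real M - real i) * (real M - real (m - Suc i)) = e\<^sup>2 - d\<^sup>2"
      "(real N - real i) * (real N - real (m - Suc i)) = c\<^sup>2 - d\<^sup>2"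
      unfolding mi c_def e_def d_def by (simp_all add: field_simps power2_eq_square)
    have "0 \<le> e" using m i by (simp add: e_def field_simps)
    then have "(y * e)\<^sup>2 \<le> c\<^sup>2" using centre y by (intro power_mono) (auto simp: c_def e_def)
    moreover have "1 * d\<^sup>2 \<le> y\<^sup>2 * d\<^sup>2" using y by (intro mult_right_mono) auto
    ultimately have "y\<^sup>2 * (e\<^sup>2 - d\<^sup>2) \<le> c\<^sup>2 - d\<^sup>2"
      by (simp add: power_mult_distrib right_diff_distrib)
    moreover have "0 \<le> (real M - real i) * (real M - real (m - Suc i))"
      using i m by (intro mult_nonneg_nonneg) auto
    ultimately show "0 \<le> y\<^sup>2 * ((real M - real i) * (real M - real (m - Suc i))) \<and>
        y\<^sup>2 * ((real M - real i) * (real M - real (m - Suc i)))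
          \<le> (real N - real i) * (real N - real (m - Suc i))"
      unfolding eqs by simp
  qed
  also have "\<dots> = P N ^ 2" by (simp add: P_sq)
  finally have "y ^ m * P M \<le> P N"
    using P_nonneg[OF m(2)] by (rule power2_le_imp_le)
  then show ?thesis by (simp add: choose divide_right_mono)
qed

text \<open>\<open>binomial_ratio_lower_bound\<close> is applied with \<open>m = k - 1\<close>,
  \<open>M = 2 * k - 1\<close> and \<open>N = n - k - 1\<close>. The two centres are then
  \<open>n - 3 * k / 2\<close> and \<open>3 * k / 2\<close>, so its centre condition is exactly the
  assumed bound \<open>n \<ge> 3 * k / 2 * (1 + y)\<close>, and
  \<open>y ^ (k - 1) * C = (t - 1) * C + t\<close>.\<close>

lemma threshold_bound:
  assumes "k \<ge> 2" "t \<ge> 2"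
    and n: "real n \<ge> 3 * real k / 2 *
        (1 + (real t - 1 + real t / real ((2 * k - 1) choose (k - 1))) powr (1 / (real k - 1)))"
  shows "(t - 1) * ((2 * k - 1) choose (k - 1)) + t \<le> (n - k - 1) choose (k - 1)"
proof -
  define C where "C = (2 * k - 1) choose (k - 1)"
  define x where "x = real t - 1 + real t / real C"
  define y where "y = x powr (1 / (real k - 1))"
  have C: "C > 0" using assms(1) by (simp add: C_def)
  have "real t / real C \<ge> 0" by simp
  then have x: "x \<ge> 1" using assms(2) unfolding x_def by linarith
  have y: "y \<ge> 1" using x assms(1) by (simp add: y_def ge_one_powr_ge_zero)
  have n': "real n \<ge> 3 * real k / 2 * (1 + y)" using n by (simp add: y_def x_def C_def)
  have "3 * real k / 2 * (1 + y) \<ge> 3 * real k / 2 * 2" using y by (intro mult_left_mono) auto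
  with n' have "real n \<ge> real (3 * k)" by simp
  then have n3: "n \<ge> 3 * k" by (simp only: of_nat_le_iff)
  have "y ^ (k - 1) * real C \<le> real ((n - k - 1) choose (k - 1))"
    unfolding C_def
  proof (rule binomial_ratio_lower_bound[OF y])
    show "k - 1 \<le> 2 * k - 1" "k - 1 \<le> n - k - 1" using n3 assms(1) by auto
    show "y * (real (2 * k - 1) - (real (k - 1) - 1) / 2) \<le> real (n - k - 1) - (real (k - 1) - 1) / 2"
      using n' n3 assms(1) by (simp add: of_nat_diff field_simps)
  qed
  moreover have "y ^ (k - 1) = x"
  proof -
    have "y ^ (k - 1) = y powr (real k - 1)"
      using y assms(1) by (simp add: powr_realpow[symmetric] of_nat_diff)
    also have "\<dots> = x" using x assms(1) by (simp add: y_def powr_powr)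
    finally show ?thesis .
  qed
  ultimately have "(real t - 1) * real C + real t \<le> real ((n - k - 1) choose (k - 1))"
    using C by (simp add: x_def distrib_right)
  moreover have "(real t - 1) * real C + real t = real ((t - 1) * C + t)"
    using assms(2) by (simp add: of_nat_diff)
  ultimately show "(t - 1) * ((2 * k - 1) choose (k - 1)) + t \<le> (n - k - 1) choose (k - 1)"
    unfolding C_def by linarith
qed

theorem theorem3:
  fixes n k t :: nat
  assumes "n \<ge> 1" and "k \<ge> 2" and "t \<ge> 2"
  shows
    "(\<forall>\<A>. \<A> \<subseteq> nsets {1..n} k \<and> one_union_intersecting t \<A> \<and>
        int (card \<A>) \<ge> int ((n - 1) choose (k - 1)) - int ((n - k - 1) choose (k - 1))
                        + (int t - 1) * int ((2 * k - 1) choose (k - 1)) + int t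
        \<longrightarrow> (\<exists>i\<in>{1..n}. \<A> \<subseteq> star n k i)) \<and>
     (real n \<ge> 3 * real k / 2 *
        (1 + (real t - 1 + real t / real ((2 * k - 1) choose (k - 1))) powr (1 / (real k - 1)))
      \<longrightarrow> (\<forall>\<A>. \<A> \<subseteq> nsets {1..n} k \<and> one_union_intersecting t \<A>
            \<longrightarrow> card \<A> \<le> (n - 1) choose (k - 1) \<and>
                (card \<A> = (n - 1) choose (k - 1) \<longleftrightarrow> (\<exists>i\<in>{1..n}. \<A> = star n k i))))"
proof -
  define C where "C = (2 * k - 1) choose (k - 1)"
  \<comment> \<open>Moving the subtracted binomial to the other side keeps the inequality within the
    naturals.\<close>
  have stability: "\<exists>i\<in>{1..n}. \<A> \<subseteq> star n k i"
    if A: "\<A> \<subseteq> nsets {1..n} k" "one_union_intersecting t \<A>"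
      and large: "((n - 1) choose (k - 1)) + (t - 1) * C + t
        \<le> card \<A> + ((n - k - 1) choose (k - 1))" for \<A>
  proof -
    obtain i where "i \<in> {1..n}" "\<forall>A\<in>\<A>. i \<in> A"
      using one_union_intersecting_subset_star[OF _ _ assms(2,3) A] large assms(1)
      by (auto simp: C_def)
    then show ?thesis using A(1) by (intro bexI[of _ i]) (auto simp: star_def)
  qed
  have card_star: "card (star n k i) = (n - 1) choose (k - 1)" if "i \<in> {1..n}" for i
    using card_nsets_containing[of "{1..n}" i k] that assms(2) by (simp add: star_def)
  have finite_star: "finite (star n k i)" for i
    by (rule finite_subset[OF _ finite_imp_finite_nsets[of "{1..n}" k]]) (auto simp: star_def)
  show ?thesis
  proof (intro conjI allI impI; elim conjE)
    fix \<A> assume A: "\<A> \<subseteq> nsets {1..n} k" "one_union_intersecting t \<A>"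
      and "int (card \<A>) \<ge> int ((n - 1) choose (k - 1)) - int ((n - k - 1) choose (k - 1))
                        + (int t - 1) * int ((2 * k - 1) choose (k - 1)) + int t"
    moreover have "(int t - 1) * int C = int ((t - 1) * C)"
      using assms(3) by (simp add: of_nat_diff)
    ultimately have "((n - 1) choose (k - 1)) + (t - 1) * C + t
        \<le> card \<A> + ((n - k - 1) choose (k - 1))"
      unfolding C_def by linarith
    with A show "\<exists>i\<in>{1..n}. \<A> \<subseteq> star n k i" by (rule stability)
  next
    fix \<A> assume n: "real n \<ge> 3 * real k / 2 *
        (1 + (real t - 1 + real t / real ((2 * k - 1) choose (k - 1))) powr (1 / (real k - 1)))"
      and A: "\<A> \<subseteq> nsets {1..n} k" "one_union_intersecting t \<A>"
    \<comment> \<open>Above the threshold, the size required by \<open>stability\<close> is at most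
      \<open>(n - 1) choose (k - 1)\<close>, so already a family of star size lies in a
      star.\<close>
    have in_star: "\<exists>i\<in>{1..n}. \<A> \<subseteq> star n k i" if "(n - 1) choose (k - 1) \<le> card \<A>"
      using stability[OF A] threshold_bound[OF assms(2,3) n] that by (simp add: C_def)
    show upper: "card \<A> \<le> (n - 1) choose (k - 1)"
    proof (rule ccontr)
      assume *: "\<not> ?thesis"
      then obtain i where "i \<in> {1..n}" "\<A> \<subseteq> star n k i" using in_star by auto
      with * show False using card_mono[OF finite_star] card_star by metis
    qed
    show "card \<A> = (n - 1) choose (k - 1) \<longleftrightarrow> (\<exists>i\<in>{1..n}. \<A> = star n k i)"
    proof
      assume eq: "card \<A> = (n - 1) choose (k - 1)"
      then obtain i where i: "i \<in> {1..n}" "\<A> \<subseteq> star n k i" using in_star by auto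
      then have "\<A> = star n k i"
        using card_subset_eq[OF finite_star i(2)] card_star eq by simp
      with i(1) show "\<exists>i\<in>{1..n}. \<A> = star n k i" by blast
    qed (use card_star in blast)
  qed
qed

end
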